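(* Let $S\equiv(S,\cdot,I,\lambda,\rho)$ be a partial semigroup, let $i,j\in I$, suppose $a\in S_{ji}$ is uniquely sandwich-regular, and let $V(a)=\{b\}$. Let $P^a=\operatorname{Reg}(S_{ij},\star_a)$, $T_1=\operatorname{Reg}(S_{ij}a,\cdot)$, $T_2=\operatorname{Reg}(aS_{ij},\cdot)$ and $W=(aS_{ij}a,\circledast)$. Then all of the maps $$\psi_1:P^a\to T_1,\ x\mapsto xa;\qquad \psi_2:P^a\to T_2,\ x\mapsto ax;\qquad \phi_1:T_1\to W,\ g\mapsto ag;\qquad \phi_2:T_2\to W,\ h\mapsto ha$$ (and hence their common composite $\phi:P^a\to W$, $x\mapsto axa$) are isomorphisms, and all of the semigroups $P^a,T_1,T_2,W$ are inverse monoids.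
   Context: A partial semigroup is a 5-tuple $(S,\cdot,I,\lambda,\rho)$ consisting of a class $S$, a partial binary operation $(x,y)\mapsto x\cdot y=xy$, a class $I$, and functions $\lambda,\rho:S\to I$ such that for all $x,y,z\in S$: (1) $xy$ is defined iff $x\rho=y\lambda$; (2) if $xy$ is defined then $(xy)\lambda=x\lambda$ and $(xy)\rho=y\rho$; (3) if $xy$ and $yz$ are defined then $(xy)z=x(yz)$; (4) for all $i,j\in I$, $S_{ij}=\{x\in S: x\lambda=i,\ x\rho=j\}$ is a set. For $x\in S$, $V(x)=\{y\in S: x=xyx,\ y=yxy\}$; $x$ is uniquely regular if $|V(x)|=1$. An element $a\in S_{ji}$ is uniquely sandwich-regular if every element of $\{a\}\cup aS_{ij}a$ is uniquely regular (in $S$). For $a\in S_{ji}$, $\star_a$ is the operation on $S_{ij}$ given by $x\star_a y=xay$. For a semigroup $T$, $\operatorname{Reg}(T)=\{x\in T:x=xyx\text{ for some }y\in T\}$. The operation $\circledast$ on $aS_{ij}a$ is $u\circledast v=ubv$, i.e. $axa\circledast aya=axaya$. Under the present hypotheses $P^a,T_1,T_2$ are subsemigroups of $(S_{ij},\star_a)$, $(S_{ij}a,\cdot)$, $(aS_{ij},\cdot)$ respectively, $W$ is a regular monoid, and the listed maps are well-defined semigroup epimorphisms. A semigroup $T$ is inverse if for each $x\in T$ there is a unique $y\in T$ with $x=xyx$ and $y=yxy$. *)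

theory Defs
  imports "HOL-Algebra.Group"
begin

text \<open>
  A partial operation is an option-valued function: \<open>xy\<close> is defined iff
  \<open>pmult S x y \<noteq> None\<close>. Maps are written on the right in the mathematical text;
  here \<open>x\<lambda>\<close> is \<open>lsrc S x\<close> and \<open>x\<rho>\<close> is \<open>rtgt S x\<close>.
  Condition (4) of the definition of a partial semigroup (each \<open>S\<^sub>i\<^sub>j\<close> is a set, not a
  proper class) is automatic, as collections are HOL sets here.
\<close>

record ('a, 'i) partial_semigroup = "'a partial_object" +
  indices :: "'i set"
  pmult :: "'a \<Rightarrow> 'a \<Rightarrow> 'a option"
  lsrc :: "'a \<Rightarrow> 'i"
  rtgt :: "'a \<Rightarrow> 'i"

locale partial_semigroup =
  fixes S (structure)
  assumes lsrc_closed: "x \<in> carrier S \<Longrightarrow> lsrc S x \<in> indices S"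
    and rtgt_closed: "x \<in> carrier S \<Longrightarrow> rtgt S x \<in> indices S"
    and pmult_closed:
      "\<lbrakk>x \<in> carrier S; y \<in> carrier S; pmult S x y = Some z\<rbrakk> \<Longrightarrow> z \<in> carrier S"
    and pmult_defined_iff:
      "\<lbrakk>x \<in> carrier S; y \<in> carrier S\<rbrakk> \<Longrightarrow> pmult S x y \<noteq> None \<longleftrightarrow> rtgt S x = lsrc S y"
    and lsrc_pmult:
      "\<lbrakk>x \<in> carrier S; y \<in> carrier S; pmult S x y = Some z\<rbrakk> \<Longrightarrow> lsrc S z = lsrc S x"
    and rtgt_pmult:
      "\<lbrakk>x \<in> carrier S; y \<in> carrier S; pmult S x y = Some z\<rbrakk> \<Longrightarrow> rtgt S z = rtgt S y"
    and pmult_assoc: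
      "\<lbrakk>x \<in> carrier S; y \<in> carrier S; z \<in> carrier S;
        pmult S x y = Some u; pmult S y z = Some v\<rbrakk> \<Longrightarrow> pmult S u z = pmult S x v"

definition pmult3 :: "('a, 'i, 'm) partial_semigroup_scheme \<Rightarrow> 'a \<Rightarrow> 'a \<Rightarrow> 'a \<Rightarrow> 'a option"
  where "pmult3 S x y z = Option.bind (pmult S x y) (\<lambda>u. pmult S u z)"

text \<open>The product as a total function, meaningful only where the product is defined.\<close>

definition pprod :: "('a, 'i, 'm) partial_semigroup_scheme \<Rightarrow> 'a \<Rightarrow> 'a \<Rightarrow> 'a" (infixl \<open>\<odot>\<index>\<close> 70)
  where "x \<odot>\<^bsub>S\<^esub> y = the (pmult S x y)"

definition hom_set :: "('a, 'i, 'm) partial_semigroup_scheme \<Rightarrow> 'i \<Rightarrow> 'i \<Rightarrow> 'a set"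
  where "hom_set S i j = {x \<in> carrier S. lsrc S x = i \<and> rtgt S x = j}"

definition inverses :: "('a, 'i, 'm) partial_semigroup_scheme \<Rightarrow> 'a \<Rightarrow> 'a set"
  where "inverses S x =
    {y \<in> carrier S. Some x = pmult3 S x y x \<and> Some y = pmult3 S y x y}"

definition uniquely_regular :: "('a, 'i, 'm) partial_semigroup_scheme \<Rightarrow> 'a \<Rightarrow> bool"
  where "uniquely_regular S x \<longleftrightarrow> card (inverses S x) = 1"

definition left_set :: "('a, 'i, 'm) partial_semigroup_scheme \<Rightarrow> 'i \<Rightarrow> 'i \<Rightarrow> 'a \<Rightarrow> 'a set"
  where "left_set S i j a = {a \<odot>\<^bsub>S\<^esub> x | x. x \<in> hom_set S i j}"

definition right_set :: "('a, 'i, 'm) partial_semigroup_scheme \<Rightarrow> 'i \<Rightarrow> 'i \<Rightarrow> 'a \<Rightarrow> 'a set"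
  where "right_set S i j a = {x \<odot>\<^bsub>S\<^esub> a | x. x \<in> hom_set S i j}"

definition both_set :: "('a, 'i, 'm) partial_semigroup_scheme \<Rightarrow> 'i \<Rightarrow> 'i \<Rightarrow> 'a \<Rightarrow> 'a set"
  where "both_set S i j a = {a \<odot>\<^bsub>S\<^esub> x \<odot>\<^bsub>S\<^esub> a | x. x \<in> hom_set S i j}"

definition uniquely_sandwich_regular ::
    "('a, 'i, 'm) partial_semigroup_scheme \<Rightarrow> 'i \<Rightarrow> 'i \<Rightarrow> 'a \<Rightarrow> bool"
  where "uniquely_sandwich_regular S i j a \<longleftrightarrow>
    a \<in> hom_set S j i \<and> (\<forall>x \<in> {a} \<union> both_set S i j a. uniquely_regular S x)"

text \<open>
  A semigroup \<open>(T, f)\<close> is packaged as a \<open>monoid\<close> record whose \<open>one\<close> field is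
  irrelevant: \<open>hom\<close> and \<open>iso\<close> look only at \<open>carrier\<close> and \<open>mult\<close>.
\<close>

definition sgrp :: "'a set \<Rightarrow> ('a \<Rightarrow> 'a \<Rightarrow> 'a) \<Rightarrow> 'a monoid"
  where "sgrp T f = \<lparr>carrier = T, mult = f, one = undefined\<rparr>"

definition Reg :: "'a monoid \<Rightarrow> 'a monoid"
  where "Reg T =
    T\<lparr>carrier := {x \<in> carrier T. \<exists>y \<in> carrier T. x = x \<otimes>\<^bsub>T\<^esub> y \<otimes>\<^bsub>T\<^esub> x}\<rparr>"

text \<open>The identity is supplied existentially, as the \<open>one\<close> field carries no information.\<close>

definition inverse_monoid :: "'a monoid \<Rightarrow> bool"
  where "inverse_monoid T \<longleftrightarrow>
    (\<exists>e. monoid (T\<lparr>one := e\<rparr>)) \<and>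
    (\<forall>x \<in> carrier T. \<exists>!y. y \<in> carrier T \<and>
       x = x \<otimes>\<^bsub>T\<^esub> y \<otimes>\<^bsub>T\<^esub> x \<and> y = y \<otimes>\<^bsub>T\<^esub> x \<otimes>\<^bsub>T\<^esub> y)"

definition P_sgrp :: "('a, 'i, 'm) partial_semigroup_scheme \<Rightarrow> 'i \<Rightarrow> 'i \<Rightarrow> 'a \<Rightarrow> 'a monoid"
  where "P_sgrp S i j a = Reg (sgrp (hom_set S i j) (\<lambda>x y. x \<odot>\<^bsub>S\<^esub> a \<odot>\<^bsub>S\<^esub> y))"

definition T1_sgrp :: "('a, 'i, 'm) partial_semigroup_scheme \<Rightarrow> 'i \<Rightarrow> 'i \<Rightarrow> 'a \<Rightarrow> 'a monoid"
  where "T1_sgrp S i j a = Reg (sgrp (right_set S i j a) (\<lambda>x y. x \<odot>\<^bsub>S\<^esub> y))"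

definition T2_sgrp :: "('a, 'i, 'm) partial_semigroup_scheme \<Rightarrow> 'i \<Rightarrow> 'i \<Rightarrow> 'a \<Rightarrow> 'a monoid"
  where "T2_sgrp S i j a = Reg (sgrp (left_set S i j a) (\<lambda>x y. x \<odot>\<^bsub>S\<^esub> y))"

text \<open>
  For \<open>b\<close> with \<open>a = aba\<close>, the operation below satisfies
  \<open>(axa) \<circledast> (aya) = (axa)b(aya) = ax(aba)ya = axaya\<close>.
\<close>

definition W_sgrp ::
    "('a, 'i, 'm) partial_semigroup_scheme \<Rightarrow> 'i \<Rightarrow> 'i \<Rightarrow> 'a \<Rightarrow> 'a \<Rightarrow> 'a monoid"
  where "W_sgrp S i j a b = sgrp (both_set S i j a) (\<lambda>u v. u \<odot>\<^bsub>S\<^esub> b \<odot>\<^bsub>S\<^esub> v)"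

end

theory Submission
  imports Defs
begin

text \<open>
  For \<open>x \<in> P\<^sup>a\<close> with \<open>\<star>\<^sub>a\<close>-inverse \<open>z\<close>, both \<open>x\<close> and \<open>b(axa)b\<close> lie in \<open>V(aza)\<close>, so unique
  regularity of \<open>aza\<close> forces \<open>x = baxab\<close>. Hence \<open>bax = x = xab\<close> on \<open>P\<^sup>a\<close>, so that \<open>b\<close> is an
  identity of \<open>P\<^sup>a\<close>, and multiplication by \<open>b\<close> inverts each of the four maps. The
  \<open>\<star>\<^sub>a\<close>-inverses of \<open>x\<close> are exactly the elements of the singleton \<open>V(axa)\<close>, so \<open>P\<^sup>a\<close> is
  an inverse monoid, and this property passes along the isomorphisms.
\<close>

section \<open>Transport of inverse monoids along isomorphisms\<close>

lemma inverse_monoid_iso: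
  assumes "f \<in> iso G H" and "inverse_monoid G"
  shows "inverse_monoid H"
proof -
  obtain e where e: "monoid (G\<lparr>one := e\<rparr>)"
    using assms(2) by (auto simp: inverse_monoid_def)
  have clG: "x \<otimes>\<^bsub>G\<^esub> y \<in> carrier G" if "x \<in> carrier G" "y \<in> carrier G" for x y
    using monoid.m_closed[OF e] that by simp
  have hom: "f (x \<otimes>\<^bsub>G\<^esub> y) = f x \<otimes>\<^bsub>H\<^esub> f y" if "x \<in> carrier G" "y \<in> carrier G" for x y
    using assms(1) that by (auto simp: iso_def hom_def)
  have inj: "inj_on f (carrier G)" and im: "carrier H = f ` carrier G"
    using assms(1) by (auto simp: iso_def bij_betw_def)
  \<comment> \<open>\<open>hom\<close> ignores the field \<open>one\<close>, so \<open>f\<close> may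
    be read as a map out of the monoid with identity \<open>e\<close>; \<open>f e\<close> is then
    the identity of the image, which is all of \<open>H\<close>.\<close>
  have "f \<in> hom (G\<lparr>one := e\<rparr>) H"
    using assms(1) by (simp add: iso_def hom_def)
  then have "monoid (H\<lparr>carrier := f ` carrier G, one := f e\<rparr>)"
    using monoid.hom_imp_img_monoid[OF e] by fastforce
  then have "monoid (H\<lparr>one := f e\<rparr>)"
    by (simp add: im[symmetric])
  moreover have "\<exists>!y. y \<in> carrier H \<and>
       x = x \<otimes>\<^bsub>H\<^esub> y \<otimes>\<^bsub>H\<^esub> x \<and> y = y \<otimes>\<^bsub>H\<^esub> x \<otimes>\<^bsub>H\<^esub> y" if "x \<in> carrier H" for x
  proof -
    obtain u where u: "u \<in> carrier G" "x = f u"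
      using \<open>x \<in> carrier H\<close> im by blast
    \<comment> \<open>By injectivity the equation is reflected as well as preserved: one direction
      gives existence of an inverse in \<open>H\<close>, the other its uniqueness.\<close>
    have eq: "f u = f u \<otimes>\<^bsub>H\<^esub> f v \<otimes>\<^bsub>H\<^esub> f u \<longleftrightarrow> u = u \<otimes>\<^bsub>G\<^esub> v \<otimes>\<^bsub>G\<^esub> u"
      if "u \<in> carrier G" "v \<in> carrier G" for u v
      using that by (simp add: hom[symmetric] clG inj_on_eq_iff[OF inj])
    obtain v where v: "v \<in> carrier G" "u = u \<otimes>\<^bsub>G\<^esub> v \<otimes>\<^bsub>G\<^esub> u" "v = v \<otimes>\<^bsub>G\<^esub> u \<otimes>\<^bsub>G\<^esub> v"
      and uniq: "\<And>w. \<lbrakk>w \<in> carrier G; u = u \<otimes>\<^bsub>G\<^esub> w \<otimes>\<^bsub>G\<^esub> u; w = w \<otimes>\<^bsub>G\<^esub> u \<otimes>\<^bsub>G\<^esub> w\<rbrakk> \<Longrightarrow> w = v"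
      using assms(2) u(1) unfolding inverse_monoid_def by metis
    show ?thesis
    proof (rule ex1I[of _ "f v"])
      show "f v \<in> carrier H \<and> x = x \<otimes>\<^bsub>H\<^esub> f v \<otimes>\<^bsub>H\<^esub> x \<and> f v = f v \<otimes>\<^bsub>H\<^esub> x \<otimes>\<^bsub>H\<^esub> f v"
        unfolding u(2) im using eq[OF u(1) v(1)] eq[OF v(1) u(1)] v by blast
    next
      fix y
      assume y: "y \<in> carrier H \<and> x = x \<otimes>\<^bsub>H\<^esub> y \<otimes>\<^bsub>H\<^esub> x \<and> y = y \<otimes>\<^bsub>H\<^esub> x \<otimes>\<^bsub>H\<^esub> y"
      then obtain w where "w \<in> carrier G" "y = f w"
        using im by blast
      with y show "y = f v"
        using eq[OF u(1)] eq[OF _ u(1)] uniq unfolding u(2) by metis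
    qed
  qed
  ultimately show ?thesis
    unfolding inverse_monoid_def by blast
qed

lemma mem_Reg_sgrp_iff:
  "x \<in> carrier (Reg (sgrp T f)) \<longleftrightarrow> x \<in> T \<and> (\<exists>y\<in>T. f (f x y) x = x)"
  unfolding Reg_def sgrp_def by (simp, metis)

section \<open>Calculation with the partial product\<close>

context partial_semigroup
begin

lemma pmult_eq_Some:
  assumes "x \<in> carrier S" "y \<in> carrier S" "rtgt S x = lsrc S y"
  shows "pmult S x y = Some (x \<odot> y)"
  using pmult_defined_iff[of x y] assms by (auto simp: pprod_def)

text \<open>
  Composability of \<open>x\<close> with \<open>y\<close> is stated as \<open>y \<in> source_set (rtgt S x)\<close> rather than by
  separate conditions on the carrier and on \<open>lsrc\<close>: proving this for a right-nested product
  takes the simplifier linear instead of exponential time.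
\<close>

definition source_set where "source_set k = {x \<in> carrier S. lsrc S x = k}"

lemma hom_setD:
  assumes "x \<in> hom_set S k l"
  shows "x \<in> carrier S" "lsrc S x = k" "rtgt S x = l" "x \<in> source_set k"
  using assms by (auto simp: hom_set_def source_set_def)

lemma pprod_simps:
  assumes "x \<in> carrier S" "y \<in> source_set (rtgt S x)"
  shows "x \<odot> y \<in> carrier S" "lsrc S (x \<odot> y) = lsrc S x" "rtgt S (x \<odot> y) = rtgt S y"
proof -
  have "y \<in> carrier S" and "pmult S x y = Some (x \<odot> y)"
    using assms pmult_eq_Some[of x y] by (auto simp: source_set_def)
  with assms(1) show "x \<odot> y \<in> carrier S" "lsrc S (x \<odot> y) = lsrc S x"
    "rtgt S (x \<odot> y) = rtgt S y"
    using pmult_closed lsrc_pmult rtgt_pmult by blast+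
qed

lemma pprod_source_set:
  "\<lbrakk>x \<in> carrier S; lsrc S x = k; y \<in> source_set (rtgt S x)\<rbrakk> \<Longrightarrow> x \<odot> y \<in> source_set k"
  using pprod_simps[of x y] by (simp add: source_set_def)

lemma pprod_assoc:
  assumes "x \<in> carrier S" "y \<in> source_set (rtgt S x)" "z \<in> source_set (rtgt S y)"
  shows "x \<odot> y \<odot> z = x \<odot> (y \<odot> z)"
proof -
  have "y \<in> carrier S" "z \<in> carrier S"
    and "pmult S x y = Some (x \<odot> y)" "pmult S y z = Some (y \<odot> z)"
    using assms pmult_eq_Some[of x y] pmult_eq_Some[of y z] by (auto simp: source_set_def)
  with assms(1) have "pmult S (x \<odot> y) z = pmult S x (y \<odot> z)"
    by (intro pmult_assoc)
  then show ?thesis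
    by (simp add: pprod_def)
qed

lemmas pprod_rules = pprod_simps pprod_source_set pprod_assoc

lemma source_setD: "x \<in> source_set k \<Longrightarrow> x \<in> carrier S" "x \<in> source_set k \<Longrightarrow> lsrc S x = k"
  by (simp_all add: source_set_def)

text \<open>\<open>pprod_assoc\<close> nests products to the right, and then
  \<open>x \<odot> (y \<odot> z)\<close> is no longer a subterm of the product with a further factor
  \<open>t\<close>. This form makes an identity usable as a rewrite rule there;
  \<open>pprod5_left\<close> does the same for identities such as xayax = x.\<close>

lemma pprod3_left:
  assumes "x \<odot> (y \<odot> z) = w"
    and "x \<in> carrier S" "y \<in> source_set (rtgt S x)" "z \<in> source_set (rtgt S y)"
      "t \<in> source_set (rtgt S z)"
  shows "x \<odot> (y \<odot> (z \<odot> t)) = w \<odot> t"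
  unfolding assms(1)[symmetric]
  using assms(2-) source_setD[OF assms(3)] source_setD[OF assms(4)] by (simp add: pprod_rules)

lemma pprod5_left:
  assumes "x \<odot> (y \<odot> (z \<odot> (u \<odot> v))) = w"
    and "x \<in> carrier S" "y \<in> source_set (rtgt S x)" "z \<in> source_set (rtgt S y)"
      "u \<in> source_set (rtgt S z)" "v \<in> source_set (rtgt S u)" "t \<in> source_set (rtgt S v)"
  shows "x \<odot> (y \<odot> (z \<odot> (u \<odot> (v \<odot> t)))) = w \<odot> t"
  unfolding assms(1)[symmetric]
  using assms(2-) source_setD[OF assms(3)] source_setD[OF assms(4)] source_setD[OF assms(5)]
    source_setD[OF assms(6)]
  by (simp add: pprod_rules)

lemma pmult3_eq_Some_iff:
  assumes "x \<in> carrier S" "y \<in> carrier S" "z \<in> carrier S"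
  shows "Some w = pmult3 S x y z \<longleftrightarrow>
    rtgt S x = lsrc S y \<and> rtgt S y = lsrc S z \<and> w = x \<odot> y \<odot> z"
proof (cases "rtgt S x = lsrc S y")
  case True
  then have "pmult3 S x y z = pmult S (x \<odot> y) z"
    using assms pmult_eq_Some by (simp add: pmult3_def)
  then show ?thesis
    using True assms pprod_simps[of x y] pmult_eq_Some[of "x \<odot> y" z]
      pmult_defined_iff[of "x \<odot> y" z]
    by (auto simp: source_set_def)
next
  case False
  then have "pmult S x y = None"
    using assms pmult_defined_iff by blast
  with False show ?thesis
    by (simp add: pmult3_def)
qed

text \<open>Definedness of xyx forces \<open>y\<close> into the opposite hom-set; there every
  product involved is defined and \<open>pmult3\<close> can be traded for the total product.\<close>

lemma mem_inverses_iff: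
  assumes "x \<in> hom_set S k l"
  shows "y \<in> inverses S x \<longleftrightarrow> y \<in> hom_set S l k \<and> x \<odot> y \<odot> x = x \<and> y \<odot> x \<odot> y = y"
  using assms by (auto simp: inverses_def hom_set_def pmult3_eq_Some_iff)

end

section \<open>The sandwich element \<open>a\<close>, its inverse \<open>b\<close>, and inverses of
  axa\<close>

locale uniquely_sandwich_regular_element = partial_semigroup +
  fixes i j a b
  assumes sandwich: "uniquely_sandwich_regular S i j a"
    and inverses_a: "inverses S a = {b}"
begin

lemma a_hom: "a \<in> hom_set S j i"
  using sandwich by (simp add: uniquely_sandwich_regular_def)

lemma b_inverse: "b \<in> hom_set S i j" "a \<odot> b \<odot> a = a" "b \<odot> a \<odot> b = b"
  using mem_inverses_iff[OF a_hom, of b] inverses_a by auto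

lemma a_simps [simp]: "a \<in> carrier S" "lsrc S a = j" "rtgt S a = i" "a \<in> source_set j"
  using hom_setD[OF a_hom] by auto

lemma b_simps [simp]: "b \<in> carrier S" "lsrc S b = i" "rtgt S b = j" "b \<in> source_set i"
  using hom_setD[OF b_inverse(1)] by auto

lemma aba [simp]: "a \<odot> (b \<odot> a) = a" and bab [simp]: "b \<odot> (a \<odot> b) = b"
  using b_inverse(2,3) by (simp_all add: pprod_rules hom_set_def)

lemma aba_left [simp]: "x \<in> source_set i \<Longrightarrow> a \<odot> (b \<odot> (a \<odot> x)) = a \<odot> x"
  using pprod3_left[OF aba] by simp

lemma bab_left [simp]: "x \<in> source_set j \<Longrightarrow> b \<odot> (a \<odot> (b \<odot> x)) = b \<odot> x"
  using pprod3_left[OF bab] by simp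

lemma inverses_sandwich:
  assumes "x \<in> hom_set S i j"
  obtains y where "inverses S (a \<odot> x \<odot> a) = {y}"
proof -
  have "uniquely_regular S (a \<odot> x \<odot> a)"
    using sandwich assms by (auto simp: uniquely_sandwich_regular_def both_set_def)
  then show thesis
    using that by (auto simp: uniquely_regular_def card_1_singleton_iff)
qed

text \<open>The condition in right-nested normal form. Its first equation, axayaxa = axa, is in
  general weaker than xayax = x; passing back requires cancelling the outer factors
  \<open>a\<close>.\<close>

lemma mem_inverses_sandwich_iff:
  assumes "x \<in> hom_set S i j"
  shows "y \<in> inverses S (a \<odot> x \<odot> a) \<longleftrightarrow> y \<in> hom_set S i j \<and>
    a \<odot> (x \<odot> (a \<odot> (y \<odot> (a \<odot> (x \<odot> a))))) = a \<odot> (x \<odot> a) \<and>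
    y \<odot> (a \<odot> (x \<odot> (a \<odot> y))) = y"
proof -
  have "a \<odot> x \<odot> a \<in> hom_set S j i"
    using hom_setD[OF assms] by (simp add: hom_set_def pprod_rules)
  note iff = mem_inverses_iff[OF this]
  show ?thesis
  proof (cases "y \<in> hom_set S i j")
    case True
    have "a \<odot> x \<odot> a \<odot> y \<odot> (a \<odot> x \<odot> a) = a \<odot> (x \<odot> (a \<odot> (y \<odot> (a \<odot> (x \<odot> a)))))"
      "y \<odot> (a \<odot> x \<odot> a) \<odot> y = y \<odot> (a \<odot> (x \<odot> (a \<odot> y)))" "a \<odot> x \<odot> a = a \<odot> (x \<odot> a)"
      using hom_setD[OF assms] hom_setD[OF True] by (simp_all add: pprod_rules)
    note eqs = this
    \<comment> \<open>The order of unfolding matters: \<open>eqs(3)\<close> would destroy the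
      left-hand sides of \<open>eqs(1)\<close> and \<open>eqs(2)\<close>.\<close>
    show ?thesis
      unfolding iff eqs(1,2) unfolding eqs(3) using True by simp
  qed (simp add: iff)
qed

text \<open>The elements for which \<open>b\<close> is a two-sided identity under the sandwich
  operation. This equational description turns out to be the carrier of \<open>P_sgrp\<close>, see
  \<open>carrier_P_sgrp\<close>.\<close>

definition P where "P = {x \<in> hom_set S i j. b \<odot> (a \<odot> x) = x \<and> x \<odot> (a \<odot> b) = x}"

lemma P_simps:
  assumes "x \<in> P"
  shows "x \<in> carrier S" "lsrc S x = i" "rtgt S x = j" "x \<in> source_set i"
    "b \<odot> (a \<odot> x) = x" "x \<odot> (a \<odot> b) = x"
  using assms hom_setD by (auto simp: P_def)

lemma P_hom_set: "x \<in> P \<Longrightarrow> x \<in> hom_set S i j"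
  by (simp add: P_def)

lemma P_ba:
  assumes "x \<in> P" shows "b \<odot> (a \<odot> (x \<odot> a)) = x \<odot> a"
  using pprod3_left[OF P_simps(5)[OF assms]] P_simps(1-4)[OF assms] by simp

lemma P_closed:
  assumes "x \<in> P" "y \<in> P" shows "x \<odot> (a \<odot> y) \<in> P"
proof -
  note x = P_simps[OF assms(1)] and y = P_simps[OF assms(2)]
  have "b \<odot> (a \<odot> (x \<odot> (a \<odot> y))) = x \<odot> (a \<odot> y)"
    using x y by (intro pprod3_left[OF x(5)]) (simp_all add: pprod_rules)
  then show ?thesis
    using x y by (simp add: P_def pprod_rules hom_set_def)
qed

lemma b_in_P: "b \<in> P"
  by (simp add: P_def pprod_rules hom_set_def)

text \<open>Sending x to baxab is a projection of \<open>hom_set S i j\<close> onto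
  \<open>P\<close>, since aba = a and elements of \<open>P\<close> are fixed.\<close>

lemma sandwich_in_P:
  assumes "x \<in> hom_set S i j" shows "b \<odot> (a \<odot> (x \<odot> (a \<odot> b))) \<in> P"
  using hom_setD[OF assms] by (simp add: P_def pprod_rules hom_set_def)

lemma regular_in_P:
  assumes x: "x \<in> hom_set S i j" and y: "y \<in> hom_set S i j"
    and reg: "x \<odot> (a \<odot> (y \<odot> (a \<odot> x))) = x"
  shows "x \<in> P"
proof -
  \<comment> \<open>The regularity witness \<open>y\<close> need not be an inverse of \<open>x\<close>, but \<open>yaxay\<close> is.\<close>
  define z where "z = y \<odot> (a \<odot> (x \<odot> (a \<odot> y)))"
  note sx = hom_setD[OF x] and sy = hom_setD[OF y]
  have z: "z \<in> hom_set S i j"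
    using sx sy by (simp add: z_def pprod_rules hom_set_def)
  note sz = hom_setD[OF z]
  have reg': "x \<odot> (a \<odot> (y \<odot> (a \<odot> (x \<odot> t)))) = x \<odot> t" if "t \<in> source_set j" for t
    using sx sy that by (intro pprod5_left[OF reg]) simp_all
  have xzx: "x \<odot> (a \<odot> (z \<odot> (a \<odot> x))) = x"
    using sx sy reg by (simp add: z_def pprod_rules reg')
  have zxz: "z \<odot> (a \<odot> (x \<odot> (a \<odot> z))) = z"
    using sx sy by (simp add: z_def pprod_rules reg')
  have xzx': "x \<odot> (a \<odot> (z \<odot> (a \<odot> (x \<odot> t)))) = x \<odot> t" if "t \<in> source_set j" for t
    using sx sz that by (intro pprod5_left[OF xzx]) simp_all
  have zxz': "z \<odot> (a \<odot> (x \<odot> (a \<odot> (z \<odot> t)))) = z \<odot> t" if "t \<in> source_set j" for t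
    using sx sz that by (intro pprod5_left[OF zxz]) simp_all
  have "x \<in> inverses S (a \<odot> z \<odot> a)"
    unfolding mem_inverses_sandwich_iff[OF z] using sx sz xzx by (simp add: hom_set_def zxz')
  \<comment> \<open>By aba = a, the outer ba and ab are absorbed by the adjacent factors
    \<open>a\<close> of aza, so this element behaves like \<open>x\<close> next to aza.\<close>
  moreover have "b \<odot> (a \<odot> (x \<odot> (a \<odot> b))) \<in> inverses S (a \<odot> z \<odot> a)"
    unfolding mem_inverses_sandwich_iff[OF z] using sx sz
    by (simp add: pprod_rules hom_set_def zxz' xzx')
  ultimately have "x = b \<odot> (a \<odot> (x \<odot> (a \<odot> b)))"
    using inverses_sandwich[OF z] by (metis singletonD)
  then show ?thesis
    using sandwich_in_P[OF x] by simp
qed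

text \<open>An inverse \<open>y\<close> of axa works. It is regular with witness \<open>x\<close>,
  hence lies in \<open>P\<close>; multiplying axayaxa = axa by \<open>b\<close> on both sides gives
  xayax = x, because bax = x = xab.\<close>

lemma P_inverse:
  assumes "x \<in> P"
  obtains y where "y \<in> P" "x \<odot> (a \<odot> (y \<odot> (a \<odot> x))) = x" "y \<odot> (a \<odot> (x \<odot> (a \<odot> y))) = y"
proof -
  note x = P_simps[OF assms] and xh = P_hom_set[OF assms]
  obtain y where "y \<in> inverses S (a \<odot> x \<odot> a)"
    using inverses_sandwich[OF xh] by blast
  then have y: "y \<in> hom_set S i j" "y \<odot> (a \<odot> (x \<odot> (a \<odot> y))) = y"
    and eq: "a \<odot> (x \<odot> (a \<odot> (y \<odot> (a \<odot> (x \<odot> a))))) = a \<odot> (x \<odot> a)"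
    using mem_inverses_sandwich_iff[OF xh] by auto
  note sy = hom_setD[OF y(1)]
  have yP: "y \<in> P"
    using regular_in_P[OF y(1) xh y(2)] .
  have bax: "b \<odot> (a \<odot> (x \<odot> t)) = x \<odot> t" if "t \<in> source_set j" for t
    using x(1-4) that by (intro pprod3_left[OF x(5)]) simp_all
  have "x \<odot> (a \<odot> (y \<odot> (a \<odot> x))) = x"
    using arg_cong[OF eq, of "\<lambda>u. b \<odot> u \<odot> b"] x sy by (simp add: pprod_rules bax)
  with yP y(2) that show thesis by blast
qed

text \<open>Both candidates are inverses of axa in \<open>S\<close>, as multiplying xawax = x by
  \<open>a\<close> on both sides shows, and axa has only one inverse.\<close>

lemma P_inverse_unique:
  assumes "x \<in> P" "y \<in> P" "z \<in> P"
    and "x \<odot> (a \<odot> (y \<odot> (a \<odot> x))) = x" "y \<odot> (a \<odot> (x \<odot> (a \<odot> y))) = y"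
    and "x \<odot> (a \<odot> (z \<odot> (a \<odot> x))) = x" "z \<odot> (a \<odot> (x \<odot> (a \<odot> z))) = z"
  shows "y = z"
proof -
  note x = P_simps[OF assms(1)] and xh = P_hom_set[OF assms(1)]
  have "w \<in> inverses S (a \<odot> x \<odot> a)"
    if "w \<in> P" "x \<odot> (a \<odot> (w \<odot> (a \<odot> x))) = x" "w \<odot> (a \<odot> (x \<odot> (a \<odot> w))) = w" for w
  proof -
    note w = P_simps(1-4)[OF that(1)]
    have "x \<odot> (a \<odot> (w \<odot> (a \<odot> (x \<odot> a)))) = x \<odot> a"
      using x(1-4) w by (intro pprod5_left[OF that(2)]) simp_all
    with that(3) w show ?thesis
      by (simp add: mem_inverses_sandwich_iff[OF xh] hom_set_def)
  qed
  then show ?thesis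
    using assms inverses_sandwich[OF xh] by (metis singletonD)
qed

section \<open>The four carriers as images of \<open>P\<close>\<close>

lemma carrier_P_sgrp: "carrier (P_sgrp S i j a) = P"
proof
  show "carrier (P_sgrp S i j a) \<subseteq> P"
  proof
    fix x assume "x \<in> carrier (P_sgrp S i j a)"
    then obtain y where xy: "x \<in> hom_set S i j" "y \<in> hom_set S i j"
      and "x \<odot> a \<odot> y \<odot> a \<odot> x = x"
      by (auto simp: P_sgrp_def mem_Reg_sgrp_iff)
    then show "x \<in> P"
      using regular_in_P[OF xy] hom_setD[OF xy(1)] hom_setD[OF xy(2)] by (simp add: pprod_rules)
  qed
next
  show "P \<subseteq> carrier (P_sgrp S i j a)"
  proof
    fix x assume x: "x \<in> P"
    then obtain y where y: "y \<in> P" "x \<odot> (a \<odot> (y \<odot> (a \<odot> x))) = x"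
      by (rule P_inverse)
    then have "x \<odot> a \<odot> y \<odot> a \<odot> x = x"
      using P_simps(1-4)[OF x] P_simps(1-4)[OF y(1)] by (simp add: pprod_rules)
    then show "x \<in> carrier (P_sgrp S i j a)"
      using P_hom_set[OF x] P_hom_set[OF y(1)] unfolding P_sgrp_def mem_Reg_sgrp_iff by blast
  qed
qed

text \<open>Regularity of xa need not place \<open>x\<close> itself in \<open>P\<close>. It is
  replaced by xayax, which is regular with witness \<open>y\<close> and has the same product with
  \<open>a\<close> on the right.\<close>

lemma carrier_T1_sgrp: "carrier (T1_sgrp S i j a) = (\<lambda>x. x \<odot> a) ` P"
proof
  show "carrier (T1_sgrp S i j a) \<subseteq> (\<lambda>x. x \<odot> a) ` P"
  proof
    fix g assume "g \<in> carrier (T1_sgrp S i j a)"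
    then obtain x y where xy: "x \<in> hom_set S i j" "y \<in> hom_set S i j"
      and g: "g = x \<odot> a" "x \<odot> a \<odot> (y \<odot> a) \<odot> (x \<odot> a) = x \<odot> a"
      by (auto simp: T1_sgrp_def mem_Reg_sgrp_iff right_set_def)
    note sxy = hom_setD[OF xy(1)] hom_setD[OF xy(2)]
    have eq: "x \<odot> (a \<odot> (y \<odot> (a \<odot> (x \<odot> a)))) = x \<odot> a"
      using g(2) sxy by (simp add: pprod_rules hom_set_def)
    \<comment> \<open>\<open>eq\<close> has six factors; \<open>pprod5_left\<close> applies with
      \<open>x \<odot> a\<close> as the fifth.\<close>
    have eq': "x \<odot> (a \<odot> (y \<odot> (a \<odot> (x \<odot> (a \<odot> t))))) = x \<odot> (a \<odot> t)"
      if "t \<in> source_set i" for t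
      using pprod5_left[OF eq, of t] sxy that by (simp add: pprod_rules hom_set_def)
    have "x \<odot> (a \<odot> (y \<odot> (a \<odot> x))) \<in> P"
      using sxy by (intro regular_in_P[OF _ xy(2)]) (simp_all add: pprod_rules hom_set_def eq')
    moreover have "g = x \<odot> (a \<odot> (y \<odot> (a \<odot> x))) \<odot> a"
      using g(1) eq sxy by (simp add: pprod_rules hom_set_def)
    ultimately show "g \<in> (\<lambda>x. x \<odot> a) ` P" by blast
  qed
next
  show "(\<lambda>x. x \<odot> a) ` P \<subseteq> carrier (T1_sgrp S i j a)"
  proof (rule image_subsetI)
    fix x assume x: "x \<in> P"
    obtain y where y: "y \<in> P" "x \<odot> (a \<odot> (y \<odot> (a \<odot> x))) = x"
      using P_inverse[OF x] by blast
    have "x \<odot> a \<odot> (y \<odot> a) \<odot> (x \<odot> a) = x \<odot> a"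
      using pprod5_left[OF y(2), of a] P_simps(1-4)[OF x] P_simps(1-4)[OF y(1)]
      by (simp add: pprod_rules hom_set_def)
    with x y(1) show "x \<odot> a \<in> carrier (T1_sgrp S i j a)"
      unfolding T1_sgrp_def mem_Reg_sgrp_iff right_set_def P_def by blast
  qed
qed

lemma carrier_T2_sgrp: "carrier (T2_sgrp S i j a) = (\<lambda>x. a \<odot> x) ` P"
proof
  show "carrier (T2_sgrp S i j a) \<subseteq> (\<lambda>x. a \<odot> x) ` P"
  proof
    fix h assume "h \<in> carrier (T2_sgrp S i j a)"
    then obtain x y where xy: "x \<in> hom_set S i j" "y \<in> hom_set S i j"
      and h: "h = a \<odot> x" "a \<odot> x \<odot> (a \<odot> y) \<odot> (a \<odot> x) = a \<odot> x"
      by (auto simp: T2_sgrp_def mem_Reg_sgrp_iff left_set_def)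
    note sxy = hom_setD[OF xy(1)] hom_setD[OF xy(2)]
    have eq: "a \<odot> (x \<odot> (a \<odot> (y \<odot> (a \<odot> x)))) = a \<odot> x"
      using h(2) sxy by (simp add: pprod_rules hom_set_def)
    have eq': "a \<odot> (x \<odot> (a \<odot> (y \<odot> (a \<odot> (x \<odot> t))))) = a \<odot> (x \<odot> t)"
      if "t \<in> source_set j" for t
      using pprod5_left[OF eq, of t] sxy that by (simp add: pprod_rules hom_set_def)
    \<comment> \<open>The same representative as for \<open>T1_sgrp\<close>; here it is the product
      with \<open>a\<close> on the left that is unchanged.\<close>
    have "x \<odot> (a \<odot> (y \<odot> (a \<odot> x))) \<in> P"
      using sxy by (intro regular_in_P[OF _ xy(2)]) (simp_all add: pprod_rules hom_set_def eq eq')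
    moreover have "h = a \<odot> (x \<odot> (a \<odot> (y \<odot> (a \<odot> x))))"
      using h(1) eq by simp
    ultimately show "h \<in> (\<lambda>x. a \<odot> x) ` P" by blast
  qed
next
  show "(\<lambda>x. a \<odot> x) ` P \<subseteq> carrier (T2_sgrp S i j a)"
  proof (rule image_subsetI)
    fix x assume x: "x \<in> P"
    obtain y where y: "y \<in> P" "x \<odot> (a \<odot> (y \<odot> (a \<odot> x))) = x"
      using P_inverse[OF x] by blast
    have "a \<odot> x \<odot> (a \<odot> y) \<odot> (a \<odot> x) = a \<odot> x"
      using y(2) P_simps(1-4)[OF x] P_simps(1-4)[OF y(1)] by (simp add: pprod_rules hom_set_def)
    with x y(1) show "a \<odot> x \<in> carrier (T2_sgrp S i j a)"
      unfolding T2_sgrp_def mem_Reg_sgrp_iff left_set_def P_def by blast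
  qed
qed

text \<open>Every axa equals a(baxab)a, and baxab lies in \<open>P\<close>.\<close>

lemma carrier_W_sgrp: "carrier (W_sgrp S i j a b) = (\<lambda>x. a \<odot> x \<odot> a) ` P"
proof
  show "carrier (W_sgrp S i j a b) \<subseteq> (\<lambda>x. a \<odot> x \<odot> a) ` P"
  proof
    fix u assume "u \<in> carrier (W_sgrp S i j a b)"
    then obtain x where x: "x \<in> hom_set S i j" "u = a \<odot> x \<odot> a"
      by (auto simp: W_sgrp_def sgrp_def both_set_def)
    then have "u = a \<odot> (b \<odot> (a \<odot> (x \<odot> (a \<odot> b)))) \<odot> a"
      using hom_setD[OF x(1)] by (simp add: pprod_rules)
    then show "u \<in> (\<lambda>x. a \<odot> x \<odot> a) ` P"
      using sandwich_in_P[OF x(1)] by blast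
  qed
qed (auto simp: W_sgrp_def sgrp_def both_set_def P_def)

section \<open>The isomorphisms, inverted by multiplication with \<open>b\<close>\<close>

lemma mult_sgrp:
  "x \<otimes>\<^bsub>P_sgrp S i j a\<^esub> y = x \<odot> a \<odot> y"
  "x \<otimes>\<^bsub>T1_sgrp S i j a\<^esub> y = x \<odot> y"
  "x \<otimes>\<^bsub>T2_sgrp S i j a\<^esub> y = x \<odot> y"
  "x \<otimes>\<^bsub>W_sgrp S i j a b\<^esub> y = x \<odot> b \<odot> y"
  by (simp_all add: P_sgrp_def T1_sgrp_def T2_sgrp_def W_sgrp_def Reg_def sgrp_def)

lemmas sgrp_simps = carrier_P_sgrp carrier_T1_sgrp carrier_T2_sgrp carrier_W_sgrp mult_sgrp

lemma psi1_iso: "(\<lambda>x. x \<odot> a) \<in> iso (P_sgrp S i j a) (T1_sgrp S i j a)"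
proof (rule isoI)
  show "(\<lambda>x. x \<odot> a) \<in> hom (P_sgrp S i j a) (T1_sgrp S i j a)"
    by (auto simp: hom_def sgrp_simps P_simps pprod_rules)
  show "bij_betw (\<lambda>x. x \<odot> a) (carrier (P_sgrp S i j a)) (carrier (T1_sgrp S i j a))"
    by (rule bij_betw_byWitness[where f' = "\<lambda>g. g \<odot> b"])
      (auto simp: sgrp_simps P_simps pprod_rules)
qed

lemma psi2_iso: "(\<lambda>x. a \<odot> x) \<in> iso (P_sgrp S i j a) (T2_sgrp S i j a)"
proof (rule isoI)
  show "(\<lambda>x. a \<odot> x) \<in> hom (P_sgrp S i j a) (T2_sgrp S i j a)"
    by (auto simp: hom_def sgrp_simps P_simps pprod_rules)
  show "bij_betw (\<lambda>x. a \<odot> x) (carrier (P_sgrp S i j a)) (carrier (T2_sgrp S i j a))"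
    by (rule bij_betw_byWitness[where f' = "\<lambda>h. b \<odot> h"])
      (auto simp: sgrp_simps P_simps pprod_rules)
qed

lemma phi1_iso: "(\<lambda>g. a \<odot> g) \<in> iso (T1_sgrp S i j a) (W_sgrp S i j a b)"
proof (rule isoI)
  show "(\<lambda>g. a \<odot> g) \<in> hom (T1_sgrp S i j a) (W_sgrp S i j a b)"
    by (auto simp: hom_def sgrp_simps P_simps pprod_rules)
  show "bij_betw (\<lambda>g. a \<odot> g) (carrier (T1_sgrp S i j a)) (carrier (W_sgrp S i j a b))"
    \<comment> \<open>Left multiplication by \<open>b\<close> sends axa back to xa, by
      \<open>P_ba\<close>.\<close>
    by (rule bij_betw_byWitness[where f' = "\<lambda>u. b \<odot> u"])
      (auto simp: sgrp_simps P_simps P_ba pprod_rules)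
qed

lemma phi2_iso: "(\<lambda>h. h \<odot> a) \<in> iso (T2_sgrp S i j a) (W_sgrp S i j a b)"
proof (rule isoI)
  show "(\<lambda>h. h \<odot> a) \<in> hom (T2_sgrp S i j a) (W_sgrp S i j a b)"
    by (auto simp: hom_def sgrp_simps P_simps pprod_rules)
  show "bij_betw (\<lambda>h. h \<odot> a) (carrier (T2_sgrp S i j a)) (carrier (W_sgrp S i j a b))"
    by (rule bij_betw_byWitness[where f' = "\<lambda>u. u \<odot> b"])
      (auto simp: sgrp_simps P_simps pprod_rules)
qed

text \<open>Factoring through \<open>T2_sgrp\<close> yields the bracketing (ax)a literally; through
  \<open>T1_sgrp\<close> it would be a(xa).\<close>

lemma phi_iso: "(\<lambda>x. a \<odot> x \<odot> a) \<in> iso (P_sgrp S i j a) (W_sgrp S i j a b)"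
  using iso_set_trans[OF psi2_iso phi2_iso] by (simp add: comp_def)

section \<open>The inverse monoid structure, with identity \<open>b\<close>\<close>

lemma inverse_monoid_P_sgrp: "inverse_monoid (P_sgrp S i j a)"
  unfolding inverse_monoid_def
proof (intro conjI exI ballI)
  show "monoid (P_sgrp S i j a\<lparr>one := b\<rparr>)"
    by (rule monoidI) (simp_all add: sgrp_simps b_in_P P_closed P_simps pprod_rules)
next
  fix x assume "x \<in> carrier (P_sgrp S i j a)"
  then have x: "x \<in> P"
    by (simp add: carrier_P_sgrp)
  have assoc: "u \<odot> a \<odot> v \<odot> a \<odot> w = u \<odot> (a \<odot> (v \<odot> (a \<odot> w)))"
    if "u \<in> P" "v \<in> P" "w \<in> P" for u v w
    using that by (simp add: P_simps pprod_rules)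
  obtain y where y: "y \<in> P" "x \<odot> (a \<odot> (y \<odot> (a \<odot> x))) = x" "y \<odot> (a \<odot> (x \<odot> (a \<odot> y))) = y"
    using P_inverse[OF x] by blast
  show "\<exists>!y. y \<in> carrier (P_sgrp S i j a) \<and>
      x = x \<otimes>\<^bsub>P_sgrp S i j a\<^esub> y \<otimes>\<^bsub>P_sgrp S i j a\<^esub> x \<and>
      y = y \<otimes>\<^bsub>P_sgrp S i j a\<^esub> x \<otimes>\<^bsub>P_sgrp S i j a\<^esub> y"
  proof (rule ex1I[of _ y], goal_cases)
    case 1
    then show ?case
      using x y by (simp add: sgrp_simps assoc)
  next
    case (2 z)
    then have z: "z \<in> P"
      by (simp add: carrier_P_sgrp)
    have "x \<odot> (a \<odot> (z \<odot> (a \<odot> x))) = x" "z \<odot> (a \<odot> (x \<odot> (a \<odot> z))) = z"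
      using 2 assoc[OF x z x] assoc[OF z x z] unfolding mult_sgrp by metis+
    then show ?case
      using P_inverse_unique[OF x z y(1)] y by simp
  qed
qed

end

theorem proposition4p1:
  fixes S :: "('a, 'i) partial_semigroup" and i j :: 'i and a b :: 'a
  assumes "partial_semigroup S"
    and "i \<in> indices S" and "j \<in> indices S"
    and "a \<in> hom_set S j i"
    and "uniquely_sandwich_regular S i j a"
    and "inverses S a = {b}"
  shows "(\<lambda>x. x \<odot>\<^bsub>S\<^esub> a) \<in> iso (P_sgrp S i j a) (T1_sgrp S i j a)
    \<and> (\<lambda>x. a \<odot>\<^bsub>S\<^esub> x) \<in> iso (P_sgrp S i j a) (T2_sgrp S i j a)
    \<and> (\<lambda>g. a \<odot>\<^bsub>S\<^esub> g) \<in> iso (T1_sgrp S i j a) (W_sgrp S i j a b)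
    \<and> (\<lambda>h. h \<odot>\<^bsub>S\<^esub> a) \<in> iso (T2_sgrp S i j a) (W_sgrp S i j a b)
    \<and> (\<lambda>x. a \<odot>\<^bsub>S\<^esub> x \<odot>\<^bsub>S\<^esub> a) \<in> iso (P_sgrp S i j a) (W_sgrp S i j a b)
    \<and> (\<forall>x \<in> carrier (P_sgrp S i j a).
         a \<odot>\<^bsub>S\<^esub> (x \<odot>\<^bsub>S\<^esub> a) = a \<odot>\<^bsub>S\<^esub> x \<odot>\<^bsub>S\<^esub> a)
    \<and> inverse_monoid (P_sgrp S i j a)
    \<and> inverse_monoid (T1_sgrp S i j a)
    \<and> inverse_monoid (T2_sgrp S i j a)
    \<and> inverse_monoid (W_sgrp S i j a b)"
proof -
  interpret uniquely_sandwich_regular_element S i j a b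
    using assms by (simp add: uniquely_sandwich_regular_element_def
        uniquely_sandwich_regular_element_axioms_def)
  note inv = inverse_monoid_P_sgrp
  \<comment> \<open>Associativity identifies the composite through \<open>T1_sgrp\<close> with the
    one through \<open>T2_sgrp\<close>.\<close>
  have "a \<odot>\<^bsub>S\<^esub> (x \<odot>\<^bsub>S\<^esub> a) = a \<odot>\<^bsub>S\<^esub> x \<odot>\<^bsub>S\<^esub> a"
    if "x \<in> carrier (P_sgrp S i j a)" for x
    using that by (simp add: carrier_P_sgrp P_simps pprod_rules)
  then show ?thesis
    using psi1_iso psi2_iso phi1_iso phi2_iso phi_iso inv
      inverse_monoid_iso[OF psi1_iso inv] inverse_monoid_iso[OF psi2_iso inv]
      inverse_monoid_iso[OF phi_iso inv]
    by blast
qed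

end
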